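(* A graph is switching equivalent to a threshold graph if and only if it is a restricted 2-threshold graph.
   Context: Graphs are finite and simple. A threshold graph is a graph in which every induced subgraph has an isolated vertex or a universal vertex. For $G=(V,E)$ and $S\subseteq V$, switching $G$ with respect to $S$ means: for every pair $\{u,v\}$ with $u\in S$, $v\notin S$, add the edge if absent and remove it if present; other pairs are unchanged. Two graphs are switching equivalent if one is obtained from the other by switching with respect to some vertex subset. Consider black/white colorings of the vertices (any map). A graph is a restricted 2-threshold graph if for some black/white coloring there is an ordering $v_1,\ldots,v_n$ of its vertices and, for each $j\ge 2$, an operator $\otimes_b$ or $\otimes_w$ such that $v_j$ is adjacent among $v_1,\ldots,v_{j-1}$ exactly to the black vertices (if its operator is $\otimes_b$) or exactly to the white vertices (if $\otimes_w$). *)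

theory Defs
  imports "Graph_Theory.Graph_Theory"
begin

text \<open>
  Finite simple graphs are the members of the locale \<^locale>\<open>pair_graph\<close>: an edge between
  \<open>u\<close> and \<open>v\<close> is the pair of arcs \<open>(u, v)\<close>, \<open>(v, u)\<close>. The null graph is allowed.
\<close>

definition isolated_vertex :: "('a, 'b) pre_digraph \<Rightarrow> 'a \<Rightarrow> bool" where
  "isolated_vertex H v \<longleftrightarrow> v \<in> verts H \<and> (\<forall>u \<in> verts H. \<not> v \<rightarrow>\<^bsub>H\<^esub> u)"

definition universal_vertex :: "('a, 'b) pre_digraph \<Rightarrow> 'a \<Rightarrow> bool" where
  "universal_vertex H v \<longleftrightarrow> v \<in> verts H \<and> (\<forall>u \<in> verts H - {v}. v \<rightarrow>\<^bsub>H\<^esub> u)"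

text \<open>
  The induced subgraph without vertices has to be left out, since it has no isolated
  and no universal vertex.
\<close>

definition threshold_graph :: "'a pair_pre_digraph \<Rightarrow> bool" where
  "threshold_graph G \<longleftrightarrow> pair_graph G \<and>
    (\<forall>H. induced_subgraph H (with_proj G) \<and> verts H \<noteq> {} \<longrightarrow>
      (\<exists>v. isolated_vertex H v \<or> universal_vertex H v))"

definition switching :: "'a pair_pre_digraph \<Rightarrow> 'a set \<Rightarrow> 'a pair_pre_digraph" where
  "switching G S = \<lparr> pverts = pverts G,
     parcs = {(u, v). u \<in> pverts G \<and> v \<in> pverts G \<and>
       (if (u \<in> S) \<noteq> (v \<in> S) then (u, v) \<notin> parcs G else (u, v) \<in> parcs G)} \<rparr>"

definition switching_equivalent :: "'a pair_pre_digraph \<Rightarrow> 'a pair_pre_digraph \<Rightarrow> bool" where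
  "switching_equivalent G H \<longleftrightarrow>
    (\<exists>S \<subseteq> pverts G. H = switching G S) \<or> (\<exists>S \<subseteq> pverts H. G = switching H S)"

datatype colour = Black | White

text \<open>
  The list \<open>vs\<close> is the vertex ordering, with indices starting at 0. The value of \<open>oper j\<close> is
  the colour to which the operator of the vertex \<open>vs ! j\<close> refers: \<^const>\<open>Black\<close> for
  \<open>\<otimes>\<^sub>b\<close> and \<^const>\<open>White\<close> for \<open>\<otimes>\<^sub>w\<close>. The first vertex has no operator; \<open>oper 0\<close> is unused.
\<close>

definition restricted_2_threshold_graph :: "'a pair_pre_digraph \<Rightarrow> bool" where
  "restricted_2_threshold_graph G \<longleftrightarrow> pair_graph G \<and>
    (\<exists>(col :: 'a \<Rightarrow> colour) vs (oper :: nat \<Rightarrow> colour).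
      distinct vs \<and> set vs = pverts G \<and>
      (\<forall>j \<in> {1..<length vs}. \<forall>i < j.
        (vs ! j, vs ! i) \<in> parcs G \<longleftrightarrow> col (vs ! i) = oper j))"

lemma pair_graph_switching:
  assumes "pair_graph G"
  shows "pair_graph (switching G S)"
proof -
  interpret pair_graph G by fact
  have s: "(u, v) \<in> parcs G \<longleftrightarrow> (v, u) \<in> parcs G" for u v
    using pair_sym_arcs by (auto simp: symmetric_def dest: symD)
  have "parcs (switching G S) \<subseteq> pverts G \<times> pverts G"
    by (auto simp: switching_def)
  then have fin: "finite (parcs (switching G S))"
    by (rule finite_subset) (simp add: pair_finite_verts)
  show ?thesis
    using fin pair_no_loops s pair_finite_verts
    by unfold_locales
      (auto simp: switching_def symmetric_def sym_def split: if_splits)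
qed

lemma switching_switching:
  assumes "pair_graph G"
  shows "switching (switching G S) S = G"
proof -
  interpret pair_graph G by fact
  show ?thesis
    by (rule pair_pre_digraph.equality)
      (auto simp: switching_def dest: in_arcsD1 in_arcsD2)
qed

end

theory Submission
  imports Defs
begin

text \<open>
  A graph is threshold iff its vertices can be ordered so that each vertex is adjacent to all
  or to none of its predecessors (repeatedly remove an isolated or a universal vertex, which
  comes last). Switching with respect to the set of black vertices complements the adjacency
  between \<open>v\<close> and its predecessors of the opposite colour, so \<open>v\<close> is adjacent to all or to
  none of its predecessors after switching iff before it was adjacent exactly to those of
  one colour.
\<close>

lemma dominates_induced_subgraph_iff:
  assumes "induced_subgraph H (with_proj G)" and "u \<in> verts H" and "v \<in> verts H"
  shows "u \<rightarrow>\<^bsub>H\<^esub> v \<longleftrightarrow> (u, v) \<in> parcs G"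
  using assms
  by (auto simp: induced_subgraph_def subgraph_def compatible_def arcs_ends_def arc_to_ends_def)

text \<open>Induced subgraphs of \<open>G\<close> correspond to subsets \<open>W\<close> of the
  vertices, so the quantifier over graphs becomes one over sets. The Boolean \<open>b\<close> merges
  the two cases: \<open>False\<close> for an isolated vertex, \<open>True\<close> for a universal
  one.\<close>

lemma threshold_graph_iff:
  "threshold_graph G \<longleftrightarrow> pair_graph G \<and>
    (\<forall>W \<subseteq> pverts G. W \<noteq> {} \<longrightarrow>
      (\<exists>v \<in> W. \<exists>b. \<forall>u \<in> W - {v}. (v, u) \<in> parcs G \<longleftrightarrow> b))"
proof (cases "pair_graph G")
  case True
  then interpret pair_graph G .
  have iso_or_univ: "(\<exists>v. isolated_vertex H v \<or> universal_vertex H v) \<longleftrightarrow>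
      (\<exists>v \<in> verts H. \<exists>b. \<forall>u \<in> verts H - {v}. (v, u) \<in> parcs G \<longleftrightarrow> b)"
    if ind: "induced_subgraph H (with_proj G)" for H
  proof -
    \<comment> \<open>Isolation also tests \<open>v\<close> against itself; as there are no loops,
      \<open>v\<close> may be left out, which gives both notions the same range.\<close>
    have "isolated_vertex H v \<longleftrightarrow> v \<in> verts H \<and> (\<forall>u \<in> verts H - {v}. (v, u) \<notin> parcs G)" for v
      using pair_no_loops[of "(v, v)"]
      by (auto simp: isolated_vertex_def dominates_induced_subgraph_iff[OF ind])
    moreover have "universal_vertex H v \<longleftrightarrow> v \<in> verts H \<and> (\<forall>u \<in> verts H - {v}. (v, u) \<in> parcs G)" for v
      by (auto simp: universal_vertex_def dominates_induced_subgraph_iff[OF ind])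
    ultimately show ?thesis
      by (simp add: ex_bool_eq) blast
  qed
  have verts_le: "verts H \<subseteq> pverts G" if "induced_subgraph H (with_proj G)" for H
    using that by (auto simp: induced_subgraph_def subgraph_def)
  have induce: "induced_subgraph (with_proj G \<restriction> W) (with_proj G)" if "W \<subseteq> pverts G" for W
    using that by (intro induced_induce) simp
  let ?P = "\<lambda>W. W \<noteq> {} \<longrightarrow> (\<exists>v \<in> W. \<exists>b. \<forall>u \<in> W - {v}. (v, u) \<in> parcs G \<longleftrightarrow> b)"
  have "(\<forall>H. induced_subgraph H (with_proj G) \<longrightarrow> ?P (verts H)) \<longleftrightarrow> (\<forall>W \<subseteq> pverts G. ?P W)"
    (is "?L \<longleftrightarrow> ?R")
  proof
    assume L: ?L
    show ?R
    proof (intro allI impI)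
      fix W assume "W \<subseteq> pverts G" "W \<noteq> {}"
      with L[rule_format, OF induce] show "\<exists>v \<in> W. \<exists>b. \<forall>u \<in> W - {v}. (v, u) \<in> parcs G \<longleftrightarrow> b"
        by simp
    qed
  next
    assume R: ?R
    show ?L
      using R[rule_format, OF verts_le] by simp
  qed
  with True iso_or_univ show ?thesis
    by (simp add: threshold_graph_def imp_conjL cong: imp_cong)
qed (simp add: threshold_graph_def)

text \<open>The induction runs over vertex sets \<open>W\<close> inside the fixed graph
  \<open>T\<close>, so no property has to be passed on to subgraphs. \<open>D v\<close> tells
  whether \<open>v\<close> is adjacent to all or to none of its predecessors.\<close>

lemma threshold_ordering:
  assumes "threshold_graph T"
  obtains vs D where "distinct vs" "set vs = pverts T"
    "sorted_wrt (\<lambda>u v. (v, u) \<in> parcs T \<longleftrightarrow> D v) vs"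
proof -
  interpret pair_graph T using assms by (simp add: threshold_graph_def)
  have "\<exists>vs D. distinct vs \<and> set vs = W \<and> sorted_wrt (\<lambda>u v. (v, u) \<in> parcs T \<longleftrightarrow> D v) vs"
    if "finite W" "W \<subseteq> pverts T" for W
    using that
  proof (induction W rule: finite_remove_induct)
    case empty
    show ?case by simp
  next
    case (remove W)
    from assms have "\<exists>v \<in> W. \<exists>b. \<forall>u \<in> W - {v}. (v, u) \<in> parcs T \<longleftrightarrow> b"
      using remove.hyps remove.prems unfolding threshold_graph_iff by blast
    then obtain v b where v: "v \<in> W" "\<forall>u \<in> W - {v}. (v, u) \<in> parcs T \<longleftrightarrow> b"
      by blast
    from v(1) have "W - {v} \<subseteq> pverts T" using remove.prems by blast
    from remove.IH[OF v(1) this] obtain vs D where vs: "distinct vs" "set vs = W - {v}"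
        "sorted_wrt (\<lambda>u v. (v, u) \<in> parcs T \<longleftrightarrow> D v) vs"
      by blast
    \<comment> \<open>Since \<open>v\<close> does not occur in \<open>vs\<close>, the update of
      \<open>D\<close> at \<open>v\<close> leaves the relation on \<open>vs\<close>
      unchanged.\<close>
    have "sorted_wrt (\<lambda>u w. (w, u) \<in> parcs T \<longleftrightarrow> (D(v := b)) w) (vs @ [v])"
    proof -
      have "sorted_wrt (\<lambda>u w. (w, u) \<in> parcs T \<longleftrightarrow> (D(v := b)) w) vs"
        using vs(2) by (intro sorted_wrt_mono_rel[OF _ vs(3)]) simp
      with vs(2) v(2) show ?thesis by (simp add: sorted_wrt_append)
    qed
    moreover have "distinct (vs @ [v])" "set (vs @ [v]) = W"
      using vs v by auto
    ultimately show ?case by blast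
  qed
  from this[of "pverts T"] show thesis
    using that pair_finite_verts by blast
qed

text \<open>In any nonempty \<open>W\<close>, the vertex that comes last in the ordering has all
  other vertices of \<open>W\<close> among its predecessors, so it is isolated or universal
  there.\<close>

lemma threshold_graphI_ordering:
  assumes "pair_graph T" and vs: "set vs = pverts T"
    and ord: "\<And>i j. i < j \<Longrightarrow> j < length vs \<Longrightarrow> (vs ! j, vs ! i) \<in> parcs T \<longleftrightarrow> d j"
  shows "threshold_graph T"
  unfolding threshold_graph_iff
proof (intro conjI allI impI)
  fix W assume W: "W \<subseteq> pverts T" "W \<noteq> {}"
  define J where "J = {j. j < length vs \<and> vs ! j \<in> W}"
  have "finite J" by (simp add: J_def)
  moreover have "J \<noteq> {}"
  proof -
    obtain v where "v \<in> W" "v \<in> set vs" using W vs by auto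
    then show ?thesis by (auto simp: J_def in_set_conv_nth)
  qed
  ultimately have m: "Max J \<in> J" "\<And>i. i \<in> J \<Longrightarrow> i \<le> Max J" by simp_all
  have "(vs ! Max J, u) \<in> parcs T \<longleftrightarrow> d (Max J)" if u: "u \<in> W - {vs ! Max J}" for u
  proof -
    obtain i where i: "i < length vs" "u = vs ! i"
      using u W vs by (metis DiffD1 in_set_conv_nth subsetD)
    with u m have "i < Max J" by (fastforce simp: J_def order.order_iff_strict)
    with m i show ?thesis by (simp add: ord J_def)
  qed
  with m show "\<exists>v \<in> W. \<exists>b. \<forall>u \<in> W - {v}. (v, u) \<in> parcs T \<longleftrightarrow> b"
    by (auto simp: J_def)
qed fact

text \<open>Switching twice with respect to the same set is the identity, so both directions of the
  equivalence reduce to switching \<open>G\<close>. The conjunct \<open>pair_graph T\<close> allows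
  \<open>switching_switching\<close> to be applied to \<open>T\<close>.\<close>

lemma switching_equivalent_iff:
  assumes "pair_graph G"
  shows "pair_graph T \<and> switching_equivalent G T \<longleftrightarrow> (\<exists>S \<subseteq> pverts G. T = switching G S)"
proof -
  have "pverts (switching H S) = pverts H" for H :: "'a pair_pre_digraph" and S
    by (simp add: switching_def)
  then show ?thesis
    unfolding switching_equivalent_def
    using assms pair_graph_switching switching_switching by metis
qed

theorem theorem8:
  fixes G :: "'a pair_pre_digraph"
  assumes "pair_graph G"
  shows "(\<exists>T. threshold_graph T \<and> switching_equivalent G T) \<longleftrightarrow> restricted_2_threshold_graph G"
proof
  assume "\<exists>T. threshold_graph T \<and> switching_equivalent G T"
  then obtain T where "threshold_graph T" "pair_graph T \<and> switching_equivalent G T"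
    by (auto simp: threshold_graph_def)
  then obtain S where "threshold_graph (switching G S)"
    unfolding switching_equivalent_iff[OF assms] by blast
  then obtain vs D where vs: "distinct vs" "set vs = pverts G"
      "sorted_wrt (\<lambda>u v. (v, u) \<in> parcs (switching G S) \<longleftrightarrow> D v) vs"
    by (rule threshold_ordering) (auto simp: switching_def)
  define col where "col v = (if v \<in> S then Black else White)" for v
  \<comment> \<open>In \<open>G\<close>, the vertex \<open>vs ! j\<close> is adjacent exactly to the
    predecessors of its own colour if \<open>D (vs ! j)\<close> holds, and to those of the other
    colour otherwise; \<open>oper j\<close> is that colour.\<close>
  define oper where "oper j = (if D (vs ! j) \<longleftrightarrow> vs ! j \<in> S then Black else White)" for j
  have "(vs ! j, vs ! i) \<in> parcs G \<longleftrightarrow> col (vs ! i) = oper j" if "i < j" "j < length vs" for i j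
  proof -
    have "vs ! i \<in> pverts G" "vs ! j \<in> pverts G"
      using that vs(2) nth_mem by (metis order.strict_trans)+
    moreover have "(vs ! j, vs ! i) \<in> parcs (switching G S) \<longleftrightarrow> D (vs ! j)"
      using sorted_wrt_nth_less[OF vs(3) that] .
    ultimately show ?thesis
      by (auto simp: switching_def col_def oper_def split: if_splits)
  qed
  with vs assms show "restricted_2_threshold_graph G"
    unfolding restricted_2_threshold_graph_def
    by (intro conjI exI[of _ col] exI[of _ vs] exI[of _ oper]) auto
next
  assume "restricted_2_threshold_graph G"
  then obtain col :: "'a \<Rightarrow> colour" and vs and oper :: "nat \<Rightarrow> colour"
    where vs: "set vs = pverts G"
      and "\<forall>j \<in> {1..<length vs}. \<forall>i < j. (vs ! j, vs ! i) \<in> parcs G \<longleftrightarrow> col (vs ! i) = oper j"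
    unfolding restricted_2_threshold_graph_def by blast
  then have adj: "(vs ! j, vs ! i) \<in> parcs G \<longleftrightarrow> col (vs ! i) = oper j"
    if "i < j" "j < length vs" for i j
    using that by simp
  \<comment> \<open>\<open>col\<close> is also defined outside the graph, hence the restriction to
    \<open>pverts G\<close>.\<close>
  define S where "S = {v \<in> pverts G. col v = Black}"
  have mem: "vs ! i \<in> pverts G" if "i < length vs" for i
    using that vs nth_mem by metis
  have "threshold_graph (switching G S)"
  proof (rule threshold_graphI_ordering)
    show "pair_graph (switching G S)" using assms by (rule pair_graph_switching)
    show "set vs = pverts (switching G S)" by (simp add: switching_def vs)
    \<comment> \<open>If the operator names the colour of \<open>vs ! j\<close> itself, switching
      adds the missing edges to the predecessors of the other colour; otherwise it removes all edges
      to predecessors.\<close>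
    show "(vs ! j, vs ! i) \<in> parcs (switching G S) \<longleftrightarrow> oper j = col (vs ! j)"
      if "i < j" "j < length vs" for i j
      using that mem[of i] mem[of j] adj[OF that]
      by (cases "col (vs ! i)"; cases "col (vs ! j)"; cases "oper j")
        (auto simp: switching_def S_def)
  qed
  moreover have "S \<subseteq> pverts G" by (auto simp: S_def)
  ultimately show "\<exists>T. threshold_graph T \<and> switching_equivalent G T"
    using switching_equivalent_iff[OF assms] by blast
qed

end
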